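(* If $H$ is a symmetric sparse semigroup of genus $g$, then $H$ is the hyperelliptic semigroup $H=\langle 2,2g+1\rangle$.
   Context: $\mathbb{N}$ is the set of natural numbers including $0$. A numerical semigroup $H\subseteq\mathbb{N}$ of genus $g\ge 1$ is a subset containing $0$, closed under addition, whose complement $\mathbb{N}\setminus H=\{1=\ell_1<\ell_2<\dots<\ell_g\}$ has exactly $g$ elements, called gaps; $\ell_g$ is the Frobenius number. $H$ is sparse if $\ell_i-\ell_{i-1}\le 2$ for all $i=2,\dots,g$, and symmetric if $\ell_g=2g-1$. $\langle A\rangle$ is the additive submonoid of $\mathbb{N}$ generated by $A$. *)

theory Defs
  imports Main "HOL.Hull"
begin

definition additive_submonoid :: "nat set \<Rightarrow> bool" where
  "additive_submonoid S \<longleftrightarrow> 0 \<in> S \<and> (\<forall>x\<in>S. \<forall>y\<in>S. x + y \<in> S)"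

definition generated_submonoid :: "nat set \<Rightarrow> nat set" where
  "generated_submonoid A = additive_submonoid hull A"

definition numerical_semigroup :: "nat set \<Rightarrow> bool" where
  "numerical_semigroup H \<longleftrightarrow> additive_submonoid H \<and> finite (- H)"

definition gaps :: "nat set \<Rightarrow> nat set" where
  "gaps H = - H"

definition genus :: "nat set \<Rightarrow> nat" where
  "genus H = card (gaps H)"

text \<open>The gaps in increasing order, indexed from 1: \<open>gap H i\<close> is $\ell_i$ for
  \<open>1 \<le> i \<le> genus H\<close>; other indices are meaningless.\<close>

definition gap :: "nat set \<Rightarrow> nat \<Rightarrow> nat" where
  "gap H i = sorted_list_of_set (gaps H) ! (i - 1)"

definition frobenius_number :: "nat set \<Rightarrow> nat" where
  "frobenius_number H = gap H (genus H)"

text \<open>The subtraction of naturals below does not truncate, since \<open>gap H\<close> is increasing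
  on \<open>{1..genus H}\<close>.\<close>

definition sparse :: "nat set \<Rightarrow> bool" where
  "sparse H \<longleftrightarrow> (\<forall>i\<in>{2..genus H}. gap H i - gap H (i - 1) \<le> 2)"

text \<open>Meaningful for genus at least 1 only.\<close>

definition symmetric :: "nat set \<Rightarrow> bool" where
  "symmetric H \<longleftrightarrow> frobenius_number H = 2 * genus H - 1"

end

theory Submission
  imports Defs
begin

text \<open>Since \<open>\<ell>\<^sub>1 = 1\<close> and \<open>\<ell>\<^sub>g = 2g - 1\<close>, the \<open>g - 1\<close> successive differences, each at most \<open>2\<close>,
  add up to \<open>2(g - 1)\<close>. So all of them equal \<open>2\<close>, and the gaps are exactly the odd numbers
  below \<open>2g\<close>.\<close>

text \<open>Telescoping, with both endpoints free: a range starting at 1 bounds a gap from above,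
  and a range ending at \<open>g\<close> bounds it from below.\<close>

lemma increments_le_2_imp_le:
  fixes f :: "nat \<Rightarrow> nat"
  assumes "\<forall>i\<in>{2..n}. f i - f (i - 1) \<le> 2" and "1 \<le> i" and "i \<le> j" and "j \<le> n"
  shows "f j \<le> f i + 2 * (j - i)"
  using assms(3,4)
proof (induction j rule: dec_induct)
  case base
  then show ?case by simp
next
  case (step j)
  \<comment> \<open>Here \<open>Suc j\<close> lies in \<open>{2..n}\<close> because
    \<open>1 \<le> i \<le> j\<close>. Even if the subtraction truncates, this yields
    \<open>f (Suc j) \<le> f j + 2\<close>.\<close>
  have "f (Suc j) - f j \<le> 2"
    using assms(1,2) step by (auto dest: bspec[of _ _ "Suc j"])
  then show ?case using step by auto
qed

lemma gaps_eq_gap_image: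
  assumes "finite (gaps H)"
  shows "gaps H = gap H ` {1..genus H}"
proof -
  have "gaps H = (\<lambda>i. sorted_list_of_set (gaps H) ! i) ` {0..<genus H}"
    using assms nth_image[of "genus H" "sorted_list_of_set (gaps H)"]
    by (simp add: genus_def)
  \<comment> \<open>List positions start at 0 and gap indices at 1, hence the shift by
    \<open>Suc\<close>.\<close>
  also have "\<dots> = gap H ` Suc ` {0..<genus H}"
    by (simp add: gap_def image_image del: image_Suc_atLeastLessThan)
  finally show ?thesis
    by (simp add: image_Suc_atLeastLessThan atLeastLessThanSuc_atLeastAtMost)
qed

text \<open>If 1 were in \<open>H\<close>, sums of 1 would fill all of the naturals and leave no
  gap, contradicting positive genus. Since 0 is in \<open>H\<close>, the least gap is then
  1.\<close>

lemma gap_1: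
  assumes "numerical_semigroup H" and "genus H \<ge> 1"
  shows "gap H 1 = 1"
proof -
  have fin: "finite (gaps H)" and H0: "0 \<in> H"
    and add: "\<And>x y. x \<in> H \<Longrightarrow> y \<in> H \<Longrightarrow> x + y \<in> H"
    using assms(1) by (auto simp: numerical_semigroup_def gaps_def additive_submonoid_def)
  have "1 \<in> gaps H"
  proof (rule ccontr)
    assume "1 \<notin> gaps H"
    then have "n \<in> H" for n
      by (induction n) (use H0 add[of 1] in \<open>auto simp: gaps_def\<close>)
    then have "H = UNIV" by auto
    then show False using assms(2) by (simp add: genus_def gaps_def)
  qed
  moreover have "Min (gaps H) \<in> gaps H"
    using fin \<open>1 \<in> gaps H\<close> by (intro Min_in) auto
  then have "Min (gaps H) \<noteq> 0" using H0 by (metis ComplD gaps_def)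
  ultimately have "Min (gaps H) = 1"
    using Min_le[OF fin, of 1] by linarith
  moreover have "sorted_list_of_set (gaps H) ! 0 = Min (gaps H)"
    using fin \<open>1 \<in> gaps H\<close> by (subst sorted_list_of_set_nonempty) auto
  ultimately show ?thesis by (simp add: gap_def)
qed

text \<open>Multiples of 2 give the even numbers, and an odd number from \<open>2 * g + 1\<close> on
  is that generator plus an even number. Conversely, the right-hand side is itself a submonoid
  containing both generators.\<close>

lemma generated_submonoid_2_odd:
  "generated_submonoid {2, 2 * g + 1} = {n. even n \<or> 2 * g + 1 \<le> n}"
proof
  have "additive_submonoid {n. even n \<or> 2 * g + 1 \<le> n}"
    by (auto simp: additive_submonoid_def)
  then show "generated_submonoid {2, 2 * g + 1} \<subseteq> {n. even n \<or> 2 * g + 1 \<le> n}"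
    unfolding generated_submonoid_def by (intro hull_minimal) auto
next
  \<comment> \<open>The hull is the intersection of all such \<open>S\<close>, so the inclusion is
    shown for each one.\<close>
  have "{n. even n \<or> 2 * g + 1 \<le> n} \<subseteq> S"
    if S: "{2, 2 * g + 1} \<subseteq> S" "additive_submonoid S" for S
  proof -
    have add: "\<And>x y. x \<in> S \<Longrightarrow> y \<in> S \<Longrightarrow> x + y \<in> S" and "0 \<in> S"
      using S(2) by (auto simp: additive_submonoid_def)
    have even: "2 * k \<in> S" for k
      by (induction k) (use S(1) \<open>0 \<in> S\<close> add[of 2] in auto)
    have "n \<in> S" if "odd n" "2 * g + 1 \<le> n" for n
    proof -
      obtain k where "n = 2 * k + 1" using \<open>odd n\<close> by (elim oddE)
      then have "n = (2 * g + 1) + 2 * (k - g)" using that by simp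
      moreover have "(2 * g + 1) + 2 * (k - g) \<in> S" by (rule add[OF _ even]) (use S(1) in auto)
      ultimately show ?thesis by (rule ssubst)
    qed
    moreover have "n \<in> S" if "even n" for n
      using that even by (metis evenE)
    ultimately show ?thesis by blast
  qed
  then show "{n. even n \<or> 2 * g + 1 \<le> n} \<subseteq> generated_submonoid {2, 2 * g + 1}"
    unfolding generated_submonoid_def hull_def by (intro Inter_greatest) auto
qed

theorem corollary2p4:
  fixes H :: "nat set" and g :: nat
  assumes "numerical_semigroup H"
    and "genus H = g"
    and "g \<ge> 1"
    and "sparse H"
    and "symmetric H"
  shows "H = generated_submonoid {2, 2 * g + 1}"
proof -
  have sparse: "\<forall>i\<in>{2..g}. gap H i - gap H (i - 1) \<le> 2"
    using assms(2,4) by (simp add: sparse_def)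
  have first: "gap H 1 = 1" and last: "gap H g = 2 * g - 1"
    using gap_1 assms by (auto simp: symmetric_def frobenius_number_def)
  \<comment> \<open>Going from 1 to \<open>i\<close> gives
    \<open>gap H i \<le> 1 + 2 * (i - 1)\<close>. Going from \<open>i\<close> to \<open>g\<close>
    gives \<open>2 * g - 1 \<le> gap H i + 2 * (g - i)\<close>, the matching lower bound.\<close>
  have gap: "gap H i = 2 * i - 1" if "i \<in> {1..g}" for i
    using increments_le_2_imp_le[OF sparse, of 1 i] increments_le_2_imp_le[OF sparse, of i g]
      first last that by auto
  have "gaps H = gap H ` {1..g}"
    using gaps_eq_gap_image[of H] assms(1,2) by (simp add: numerical_semigroup_def gaps_def)
  also have "\<dots> = (\<lambda>i. 2 * i - 1) ` {1..g}"
    using gap by (intro image_cong) auto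
  also have "\<dots> = {n. odd n \<and> n < 2 * g + 1}"
  proof (intro equalityI subsetI)
    fix n assume "n \<in> {n. odd n \<and> n < 2 * g + 1}"
    then obtain k where "n = 2 * k + 1" "k < g" by (auto elim!: oddE)
    then show "n \<in> (\<lambda>i. 2 * i - 1) ` {1..g}" by (intro image_eqI[of _ _ "k + 1"]) auto
  qed auto
  finally have "H = - {n. odd n \<and> n < 2 * g + 1}" by (auto simp: gaps_def)
  then show ?thesis unfolding generated_submonoid_2_odd by auto
qed

end
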